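(* Let $0<q<1$ and $c_r=\frac12[2r]_q=\frac{1-q^{2r}}{2(1-q)}$. No ordinary differential local operator $T$ can satisfy the exact rank-one scalar radial restriction $$T(H^re)=c_r\,Z^\dagger H^{r-1}e\qquad\text{for all }r\ge1,$$ for a fixed (nonzero) fermionic coefficient vector $e$.
   Context: One bosonic label: independent commuting variables $z_1,\dots,z_m,\bar z_1,\dots,\bar z_m$ ($m\ge1$), $H=\sum_az_a\bar z_a$, $Z^\dagger=\sum_a\bar z_af_a^\dagger$, where $f_a,f_a^\dagger$ is a Witt basis of the complex Clifford algebra $\mathrm{Cl}_{2m}$ ($\{f_a,f_b\}=\{f_a^\dagger,f_b^\dagger\}=0$, $\{f_a,f_b^\dagger\}=\delta_{ab}$). Operators act on polynomials in $z,\bar z$ with values in the coefficient space $\mathrm{Cl}_{2m}\otimes F$, where $F$ is the space of fermionic coefficients and $e\in F$. An operator is *ordinary differential local* if it is a fixed finite sum $T=\sum_{|\alpha|+|\beta|\le R}P_{\alpha,\beta}(z,\bar z)\partial_z^\alpha\partial_{\bar z}^\beta$ with polynomial coefficients $P_{\alpha,\beta}$ (with values in operators on the coefficient space) and $R$ independent of the polynomial degree. *)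

theory Defs
  imports Complex_Main "HOL-Library.Poly_Mapping" "HOL-Library.Function_Algebras"
    "HOL-Library.Cardinality" "HOL-Library.FuncSet"
begin

section \<open>Complex vector spaces and algebras\<close>

class complex_vector = ab_group_add +
  fixes scaleC :: "complex \<Rightarrow> 'a \<Rightarrow> 'a"  (infixr \<open>*\<^sub>C\<close> 75)
  assumes scaleC_add_right: "a *\<^sub>C (x + y) = a *\<^sub>C x + a *\<^sub>C y"
    and scaleC_add_left: "(a + b) *\<^sub>C x = a *\<^sub>C x + b *\<^sub>C x"
    and scaleC_scaleC: "a *\<^sub>C b *\<^sub>C x = (a * b) *\<^sub>C x"
    and scaleC_one: "1 *\<^sub>C x = x"

global_interpretation complex_vector: vector_space "scaleC :: complex \<Rightarrow> 'a \<Rightarrow> 'a::complex_vector"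
  by unfold_locales (simp_all add: scaleC_add_right scaleC_add_left scaleC_scaleC scaleC_one)

class complex_algebra_1 = complex_vector + ring_1 +
  assumes mult_scaleC_left: "(a *\<^sub>C x) * y = a *\<^sub>C (x * y)"
    and mult_scaleC_right: "x * (a *\<^sub>C y) = a *\<^sub>C (x * y)"

instantiation complex :: complex_vector
begin

definition "scaleC a (x::complex) = a * x"

instance
  by standard (simp_all add: scaleC_complex_def algebra_simps)

end

lemma lookup_map_zero:
  "f 0 = 0 \<Longrightarrow> Poly_Mapping.lookup (Poly_Mapping.map f p) k = f (Poly_Mapping.lookup p k)"
  by (simp add: Poly_Mapping.map.rep_eq when_def)

instantiation poly_mapping :: (type, complex_vector) complex_vector
begin

definition "scaleC a p = Poly_Mapping.map (scaleC a) p"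

lemma lookup_scaleC: "Poly_Mapping.lookup (a *\<^sub>C p) k = a *\<^sub>C Poly_Mapping.lookup p k"
  for p :: "'a \<Rightarrow>\<^sub>0 'b"
  by (simp add: scaleC_poly_mapping_def lookup_map_zero)

instance
  by standard
    (auto intro!: poly_mapping_eqI simp: lookup_scaleC lookup_add
      scaleC_add_right scaleC_add_left scaleC_scaleC scaleC_one)

end


section \<open>Tensor product over the complex numbers\<close>

text \<open>
  The free vector space on \<open>'a \<times> 'b\<close> is \<open>('a \<times> 'b) \<Rightarrow>\<^sub>0 complex\<close>; the tensor product is
  its quotient by the span of the relators that force \<open>(x, y) \<mapsto> x \<otimes> y\<close> to be bilinear.
\<close>

definition pure :: "'a \<Rightarrow> 'b \<Rightarrow> ('a \<times> 'b) \<Rightarrow>\<^sub>0 complex" where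
  "pure x y = Poly_Mapping.single (x, y) 1"

definition tensor_relators ::
  "(('a::complex_vector \<times> 'b::complex_vector) \<Rightarrow>\<^sub>0 complex) set" where
  "tensor_relators =
     {pure (x + x') y - (pure x y + pure x' y) | x x' y. True} \<union>
     {pure x (y + y') - (pure x y + pure x y') | x y y'. True} \<union>
     {pure (a *\<^sub>C x) y - a *\<^sub>C pure x y | a x y. True} \<union>
     {pure x (a *\<^sub>C y) - a *\<^sub>C pure x y | a x y. True}"

definition tensor_rel ::
  "(('a::complex_vector \<times> 'b::complex_vector) \<Rightarrow>\<^sub>0 complex) \<Rightarrow> (('a \<times> 'b) \<Rightarrow>\<^sub>0 complex) \<Rightarrow> bool" where
  "tensor_rel u v \<longleftrightarrow> u - v \<in> complex_vector.span tensor_relators"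

lemma equivp_tensor_rel:
  "equivp (tensor_rel :: ('c::complex_vector \<times> 'd::complex_vector \<Rightarrow>\<^sub>0 complex) \<Rightarrow> _)"
proof (rule equivpI)
  show "reflp (tensor_rel :: ('c \<times> 'd \<Rightarrow>\<^sub>0 complex) \<Rightarrow> _)"
    by (simp add: reflp_def tensor_rel_def complex_vector.span_zero)
  show "symp (tensor_rel :: ('c \<times> 'd \<Rightarrow>\<^sub>0 complex) \<Rightarrow> _)"
    unfolding symp_def tensor_rel_def
    by (metis complex_vector.span_neg minus_diff_eq)
  show "transp (tensor_rel :: ('c \<times> 'd \<Rightarrow>\<^sub>0 complex) \<Rightarrow> _)"
    unfolding transp_def tensor_rel_def
  proof (intro allI impI)
    fix u v w :: "('c::complex_vector \<times> 'd::complex_vector) \<Rightarrow>\<^sub>0 complex"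
    assume "u - v \<in> complex_vector.span tensor_relators" "v - w \<in> complex_vector.span tensor_relators"
    from complex_vector.span_add[OF this] show "u - w \<in> complex_vector.span tensor_relators"
      by simp
  qed
qed

lemma tensor_rel_refl: "u = v \<Longrightarrow> tensor_rel u v"
  by (simp add: tensor_rel_def complex_vector.span_zero)

quotient_type (overloaded) ('a, 'b) tensor =
  "('a::complex_vector \<times> 'b::complex_vector) \<Rightarrow>\<^sub>0 complex" / tensor_rel
  by (rule equivp_tensor_rel)

lemma diff_diff_add_swap: "(a - b) - (c - d) = (a - c) - (b - d)" for a b c d :: "'a::ab_group_add"
  by (simp add: algebra_simps)

instantiation tensor :: (complex_vector, complex_vector) complex_vector
begin

lift_definition zero_tensor :: "('a, 'b) tensor" is 0 .

lift_definition plus_tensor :: "('a, 'b) tensor \<Rightarrow> ('a, 'b) tensor \<Rightarrow> ('a, 'b) tensor" is "(+)"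
  unfolding tensor_rel_def by (simp add: add_diff_add complex_vector.span_add)

lift_definition uminus_tensor :: "('a, 'b) tensor \<Rightarrow> ('a, 'b) tensor" is uminus
  unfolding tensor_rel_def
  by (subst minus_diff_minus) (rule complex_vector.span_neg)

lift_definition minus_tensor :: "('a, 'b) tensor \<Rightarrow> ('a, 'b) tensor \<Rightarrow> ('a, 'b) tensor" is "(-)"
  unfolding tensor_rel_def by (subst diff_diff_add_swap) (rule complex_vector.span_diff)

lift_definition scaleC_tensor :: "complex \<Rightarrow> ('a, 'b) tensor \<Rightarrow> ('a, 'b) tensor" is scaleC
  unfolding tensor_rel_def
  by (subst complex_vector.scale_right_diff_distrib[symmetric]) (rule complex_vector.span_scale)

instance
proof
  fix x y z :: "('a, 'b) tensor" and a b :: complex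
  show "x + y + z = x + (y + z)"
    by transfer (rule tensor_rel_refl, rule add.assoc)
  show "x + y = y + x"
    by transfer (rule tensor_rel_refl, rule add.commute)
  show "0 + x = x"
    by transfer (rule tensor_rel_refl, rule add_0_left)
  show "- x + x = 0"
    by transfer (rule tensor_rel_refl, rule left_minus)
  show "x - y = x + - y"
    by transfer (rule tensor_rel_refl, rule diff_conv_add_uminus)
  show "a *\<^sub>C (x + y) = a *\<^sub>C x + a *\<^sub>C y"
    by transfer (rule tensor_rel_refl, rule scaleC_add_right)
  show "(a + b) *\<^sub>C x = a *\<^sub>C x + b *\<^sub>C x"
    by transfer (rule tensor_rel_refl, rule scaleC_add_left)
  show "a *\<^sub>C b *\<^sub>C x = (a * b) *\<^sub>C x"
    by transfer (rule tensor_rel_refl, rule scaleC_scaleC)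
  show "1 *\<^sub>C x = x"
    by transfer (rule tensor_rel_refl, rule scaleC_one)
qed

end

lift_definition tensor :: "'a::complex_vector \<Rightarrow> 'b::complex_vector \<Rightarrow> ('a, 'b) tensor"
  (infixr \<open>\<otimes>\<close> 76) is pure .

lemma tensor_eqI: "u - v \<in> tensor_relators \<Longrightarrow> tensor_rel u v"
  by (simp add: tensor_rel_def complex_vector.span_base)

lemma tensor_add_left: "(x + x') \<otimes> y = x \<otimes> y + x' \<otimes> y"
  by transfer (rule tensor_eqI, unfold tensor_relators_def, blast)

lemma tensor_add_right: "x \<otimes> (y + y') = x \<otimes> y + x \<otimes> y'"
  by transfer (rule tensor_eqI, unfold tensor_relators_def, blast)

lemma tensor_scaleC_left: "(a *\<^sub>C x) \<otimes> y = a *\<^sub>C (x \<otimes> y)"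
  by transfer (rule tensor_eqI, unfold tensor_relators_def, blast)

lemma tensor_scaleC_right: "x \<otimes> (a *\<^sub>C y) = a *\<^sub>C (x \<otimes> y)"
  by transfer (rule tensor_eqI, unfold tensor_relators_def, blast)

lemma tensor_zero_left: "0 \<otimes> y = 0"
  by (metis add_cancel_right_right tensor_add_left)


section \<open>Witt bases of the complex Clifford algebra\<close>

text \<open>
  With \<open>m = CARD('n)\<close>, the type \<open>'c\<close> is a copy of the complex Clifford algebra on \<open>2m\<close>
  generators: it is generated as a unital algebra by the \<open>f a\<close>, \<open>fd a\<close> and has dimension
  \<open>2 ^ (2 * m)\<close>. The library's \<open>dim\<close> is \<open>0\<close> in the infinite-dimensional case, so the
  last conjunct includes finite-dimensionality.
\<close>

definition clifford_witt_basis ::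
  "('n::finite \<Rightarrow> 'c::complex_algebra_1) \<Rightarrow> ('n \<Rightarrow> 'c) \<Rightarrow> bool" where
  "clifford_witt_basis f fd \<longleftrightarrow>
     (\<forall>a b. f a * f b + f b * f a = 0) \<and>
     (\<forall>a b. fd a * fd b + fd b * fd a = 0) \<and>
     (\<forall>a b. f a * fd b + fd b * f a = (if a = b then 1 else 0)) \<and>
     complex_vector.span (prod_list ` lists (range f \<union> range fd)) = (UNIV :: 'c set) \<and>
     complex_vector.dim (UNIV :: 'c set) = 2 ^ (2 * CARD('n))"


section \<open>Polynomials with coefficients in a vector space\<close>

text \<open>
  The variables are \<open>z a = Inl a\<close> and \<open>zbar a = Inr a\<close> for \<open>a :: 'n\<close>. Monomials and
  multi-indices \<open>(\<alpha>, \<beta>)\<close> are both represented by exponent functions on \<open>'n + 'n\<close>.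
\<close>

type_synonym 'n multi_index = "('n + 'n) \<Rightarrow>\<^sub>0 nat"

type_synonym ('n, 'w) vpoly = "'n multi_index \<Rightarrow>\<^sub>0 'w"

abbreviation var_z :: "'n \<Rightarrow> ('n, 'c::ring_1) vpoly" where
  "var_z a \<equiv> Poly_Mapping.single (Poly_Mapping.single (Inl a) 1) 1"

abbreviation var_zbar :: "'n \<Rightarrow> ('n, 'c::ring_1) vpoly" where
  "var_zbar a \<equiv> Poly_Mapping.single (Poly_Mapping.single (Inr a) 1) 1"

abbreviation const_poly :: "'c::zero \<Rightarrow> ('n, 'c) vpoly" where
  "const_poly c \<equiv> Poly_Mapping.single 0 c"

definition H :: "('n::finite, 'c::ring_1) vpoly" where
  "H = (\<Sum>a\<in>UNIV. var_z a * var_zbar a)"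

definition Zdag :: "('n::finite \<Rightarrow> 'c::ring_1) \<Rightarrow> ('n, 'c) vpoly" where
  "Zdag fd = (\<Sum>a\<in>UNIV. var_zbar a * const_poly (fd a))"

text \<open>
  A Clifford-valued polynomial \<open>p\<close> applied to a constant \<open>e\<close>: since \<open>f\<^sub>a\<^sup>\<dagger>\<close> acts on
  \<open>C \<otimes> F\<close> by left multiplication in \<open>C\<close> and \<open>e\<close> stands for \<open>1 \<otimes> e\<close>, the coefficient \<open>c\<close>
  of each monomial becomes \<open>c \<otimes> e\<close>.
\<close>

definition apply_coeff ::
  "('n, 'c::complex_vector) vpoly \<Rightarrow> 'f::complex_vector \<Rightarrow> ('n, ('c, 'f) tensor) vpoly"
  (infixl \<open>\<bullet>\<close> 74) where
  "p \<bullet> e = Poly_Mapping.map (\<lambda>c. c \<otimes> e) p"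

lemma lookup_apply_coeff:
  "Poly_Mapping.lookup (p \<bullet> e) \<gamma> = Poly_Mapping.lookup p \<gamma> \<otimes> e"
  by (simp add: apply_coeff_def lookup_map_zero tensor_zero_left)


section \<open>Differential operators with polynomial coefficients\<close>

definition partial ::
  "'n + 'n \<Rightarrow> ('n, 'w::complex_vector) vpoly \<Rightarrow> ('n, 'w) vpoly" where
  "partial v p = (\<Sum>\<gamma>\<in>Poly_Mapping.keys p.
     Poly_Mapping.single (\<gamma> - Poly_Mapping.single v 1)
       (of_nat (Poly_Mapping.lookup \<gamma> v) *\<^sub>C Poly_Mapping.lookup p \<gamma>))"

text \<open>The fold below is independent of the order of the variables by \<open>partial_pow_commute\<close>.\<close>

definition partials ::
  "'n::finite multi_index \<Rightarrow> ('n, 'w::complex_vector) vpoly \<Rightarrow> ('n, 'w) vpoly" where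
  "partials \<alpha> p = Finite_Set.fold (\<lambda>v. partial v ^^ Poly_Mapping.lookup \<alpha> v) p UNIV"

lemma lookup_partial:
  "Poly_Mapping.lookup (partial v p) \<delta> =
     of_nat (Poly_Mapping.lookup \<delta> v + 1) *\<^sub>C
       Poly_Mapping.lookup p (\<delta> + Poly_Mapping.single v 1)"
proof -
  let ?e = "Poly_Mapping.single v (1::nat)"
  have shift: "\<gamma> = \<delta> + ?e" if "\<gamma> - ?e = \<delta>" "Poly_Mapping.lookup \<gamma> v \<noteq> 0" for \<gamma>
  proof (rule poly_mapping_eqI)
    fix k
    have "Poly_Mapping.lookup \<delta> k = Poly_Mapping.lookup \<gamma> k - Poly_Mapping.lookup ?e k"
      unfolding that(1)[symmetric] lookup_minus ..
    moreover have "Poly_Mapping.lookup ?e k \<le> Poly_Mapping.lookup \<gamma> k"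
      using that(2) by (cases "k = v") (simp_all add: lookup_single_not_eq)
    ultimately show "Poly_Mapping.lookup \<gamma> k = Poly_Mapping.lookup (\<delta> + ?e) k"
      unfolding lookup_add by linarith
  qed
  have "Poly_Mapping.lookup (partial v p) \<delta> =
      (\<Sum>\<gamma>\<in>Poly_Mapping.keys p.
        if \<gamma> = \<delta> + ?e then of_nat (Poly_Mapping.lookup \<gamma> v) *\<^sub>C Poly_Mapping.lookup p \<gamma> else 0)"
    unfolding partial_def lookup_sum
  proof (rule sum.cong[OF refl])
    fix \<gamma>
    show "Poly_Mapping.lookup (Poly_Mapping.single (\<gamma> - ?e)
            (of_nat (Poly_Mapping.lookup \<gamma> v) *\<^sub>C Poly_Mapping.lookup p \<gamma>)) \<delta> =
          (if \<gamma> = \<delta> + ?e then of_nat (Poly_Mapping.lookup \<gamma> v) *\<^sub>C Poly_Mapping.lookup p \<gamma> else 0)"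
    proof (cases "Poly_Mapping.lookup \<gamma> v = 0")
      case False
      then have "\<gamma> - ?e = \<delta> \<longleftrightarrow> \<gamma> = \<delta> + ?e"
        using shift[of \<gamma>] by (metis add_diff_cancel_right')
      then show ?thesis
        by (simp only: lookup_single when_def)
    qed auto
  qed
  also have "\<dots> = of_nat (Poly_Mapping.lookup (\<delta> + ?e) v) *\<^sub>C Poly_Mapping.lookup p (\<delta> + ?e)"
    by (simp add: in_keys_iff)
  also have "Poly_Mapping.lookup (\<delta> + ?e) v = Poly_Mapping.lookup \<delta> v + 1"
    by (simp only: lookup_add lookup_single_eq)
  finally show ?thesis .
qed

lemma partial_commute: "partial v (partial w p) = partial w (partial v p)"
proof (cases "v = w")
  case False
  show ?thesis
  proof (rule poly_mapping_eqI)
    fix \<gamma>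
    let ?v = "Poly_Mapping.single v (1::nat)" and ?w = "Poly_Mapping.single w (1::nat)"
    have "Poly_Mapping.lookup (\<gamma> + ?v) w = Poly_Mapping.lookup \<gamma> w"
      and "Poly_Mapping.lookup (\<gamma> + ?w) v = Poly_Mapping.lookup \<gamma> v"
      using False by (simp_all add: lookup_add lookup_single_not_eq)
    moreover have "\<gamma> + ?v + ?w = \<gamma> + ?w + ?v"
      by (simp only: ac_simps)
    ultimately show "Poly_Mapping.lookup (partial v (partial w p)) \<gamma> =
        Poly_Mapping.lookup (partial w (partial v p)) \<gamma>"
      by (simp only: lookup_partial scaleC_scaleC mult.commute)
  qed
qed simp

lemma partial_pow_commute:
  fixes v w :: "'a + 'a"
  shows "(partial v ^^ k) \<circ> (partial w ^^ l) =
    (partial w ^^ l) \<circ> (partial v ^^ k :: ('a, 'b::complex_vector) vpoly \<Rightarrow> _)"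
proof -
  have 1: "partial v ((partial w ^^ l) p) = (partial w ^^ l) (partial v p)" for p :: "('a, 'b) vpoly"
    by (induction l) (simp_all add: partial_commute[of v w])
  have "(partial v ^^ k) ((partial w ^^ l) p) = (partial w ^^ l) ((partial v ^^ k) p)" for p :: "('a, 'b) vpoly"
    by (induction k) (simp_all add: 1)
  then show ?thesis
    by (simp add: fun_eq_iff)
qed

definition total_degree :: "'n::finite multi_index \<Rightarrow> nat" where
  "total_degree \<alpha> = (\<Sum>v\<in>UNIV. Poly_Mapping.lookup \<alpha> v)"

lemma finite_total_degree_le: "finite {\<alpha> :: 'n::finite multi_index. total_degree \<alpha> \<le> R}"
proof (rule finite_imageD)
  let ?D = "{\<alpha> :: 'n multi_index. total_degree \<alpha> \<le> R}"
  have "Poly_Mapping.lookup \<alpha> v \<le> total_degree \<alpha>" for \<alpha> :: "'n multi_index" and v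
    unfolding total_degree_def by (rule member_le_sum) simp_all
  then have "Poly_Mapping.lookup ` ?D \<subseteq> PiE UNIV (\<lambda>_. {..R})"
    unfolding PiE_UNIV_domain by (fastforce intro: order_trans)
  then show "finite (Poly_Mapping.lookup ` ?D)"
    by (rule finite_subset) (rule finite_PiE, simp_all)
  show "inj_on Poly_Mapping.lookup ?D"
    by (rule inj_onI) (simp only: poly_mapping_eq_iff)
qed

text \<open>
  An operator-valued polynomial is a \<open>('n, 'w \<Rightarrow> 'w) vpoly\<close> with linear coefficients; it acts
  by multiplying monomials and applying its coefficients to those of the argument.
\<close>

definition op_poly_act ::
  "('n, 'w \<Rightarrow> 'w::complex_vector) vpoly \<Rightarrow> ('n, 'w) vpoly \<Rightarrow> ('n, 'w) vpoly" where
  "op_poly_act P p = (\<Sum>\<gamma>\<in>Poly_Mapping.keys P. \<Sum>\<delta>\<in>Poly_Mapping.keys p.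
     Poly_Mapping.single (\<gamma> + \<delta>) (Poly_Mapping.lookup P \<gamma> (Poly_Mapping.lookup p \<delta>)))"

definition op_poly_linear :: "('n, 'w \<Rightarrow> 'w::complex_vector) vpoly \<Rightarrow> bool" where
  "op_poly_linear P \<longleftrightarrow>
     (\<forall>\<gamma>. Vector_Spaces.linear scaleC scaleC (Poly_Mapping.lookup P \<gamma>))"

definition ordinary_differential_local ::
  "(('n::finite, 'w::complex_vector) vpoly \<Rightarrow> ('n, 'w) vpoly) \<Rightarrow> bool" where
  "ordinary_differential_local T \<longleftrightarrow>
     (\<exists>R. \<exists>P :: 'n multi_index \<Rightarrow> ('n, 'w \<Rightarrow> 'w) vpoly.
        (\<forall>\<alpha>. op_poly_linear (P \<alpha>)) \<and>
        (\<forall>p. T p = (\<Sum>\<alpha> | total_degree \<alpha> \<le> R. op_poly_act (P \<alpha>) (partials \<alpha> p))))"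


section \<open>The rank-one radial coefficients\<close>

definition q_number :: "real \<Rightarrow> nat \<Rightarrow> real" where
  "q_number q n = (1 - q ^ n) / (1 - q)"

definition radial_coeff :: "real \<Rightarrow> nat \<Rightarrow> real" where
  "radial_coeff q r = q_number q (2 * r) / 2"

end

theory Submission
  imports Defs "HOL-Computational_Algebra.Polynomial"
begin

text \<open>
  Fix an index \<open>a\<close> and compare the coefficients of \<open>z\<^sub>a\<^bsup>r-1\<^esup> zbar\<^sub>a\<^bsup>r\<^esup>\<close>. On the right-hand side it
  is \<open>c\<^sub>r (f\<^sub>a\<^sup>\<dagger> \<otimes> e)\<close> with \<open>f\<^sub>a\<^sup>\<dagger> \<otimes> e \<noteq> 0\<close>. On the left-hand side only monomials of \<open>H\<^sup>r\<close> within a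
  bounded distance contribute; their coefficients are binomial coefficients \<open>r choose s\<close> with
  fixed \<open>s\<close>, up to constants, and differentiation contributes factors polynomial in \<open>r\<close>. So
  \<open>c\<^sub>r\<close>, and with it \<open>q\<^bsup>2r\<^esup>\<close>, would agree with a polynomial \<open>P\<close> for large \<open>r\<close>. But then
  \<open>P (x + 1) = q\<^sup>2 P x\<close>, and leading coefficients force \<open>q\<^sup>2 = 1\<close>.
\<close>

section \<open>Sequences that eventually agree with a complex polynomial\<close>

abbreviation lookup :: "('a \<Rightarrow>\<^sub>0 'b::zero) \<Rightarrow> 'a \<Rightarrow> 'b" where
  "lookup \<equiv> Poly_Mapping.lookup"

text \<open>Agreement is required only for large r, because exponents such as \<open>r - 1\<close>
  and \<open>\<mu> r - \<gamma>\<close> are truncated at 0 and follow a polynomial formula only from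
  some point on.\<close>

definition eventually_poly :: "(nat \<Rightarrow> complex) \<Rightarrow> bool" where
  "eventually_poly g \<longleftrightarrow> (\<exists>p. \<forall>\<^sub>F r in sequentially. g r = poly p (of_nat r))"

lemma eventually_poly_cong:
  assumes "eventually_poly g" "\<forall>\<^sub>F r in sequentially. h r = g r"
  shows "eventually_poly h"
proof -
  from assms(1) obtain p where "\<forall>\<^sub>F r in sequentially. g r = poly p (of_nat r)"
    unfolding eventually_poly_def by blast
  with assms(2) have "\<forall>\<^sub>F r in sequentially. h r = poly p (of_nat r)"
    by eventually_elim simp
  then show ?thesis
    unfolding eventually_poly_def by blast
qed

lemma eventually_poly_const: "eventually_poly (\<lambda>_. c)"
  unfolding eventually_poly_def by (intro exI[of _ "[:c:]"]) simp

lemma eventually_poly_of_nat: "eventually_poly of_nat"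
  unfolding eventually_poly_def by (intro exI[of _ "[:0, 1:]"]) simp

lemma eventually_poly_add:
  assumes "eventually_poly g" "eventually_poly h"
  shows "eventually_poly (\<lambda>r. g r + h r)"
proof -
  from assms obtain p p' where
    "\<forall>\<^sub>F r in sequentially. g r = poly p (of_nat r)" "\<forall>\<^sub>F r in sequentially. h r = poly p' (of_nat r)"
    unfolding eventually_poly_def by blast
  then have "\<forall>\<^sub>F r in sequentially. g r + h r = poly (p + p') (of_nat r)"
    by eventually_elim simp
  then show ?thesis unfolding eventually_poly_def by blast
qed

lemma eventually_poly_mult:
  assumes "eventually_poly g" "eventually_poly h"
  shows "eventually_poly (\<lambda>r. g r * h r)"
proof -
  from assms obtain p p' where
    "\<forall>\<^sub>F r in sequentially. g r = poly p (of_nat r)" "\<forall>\<^sub>F r in sequentially. h r = poly p' (of_nat r)"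
    unfolding eventually_poly_def by blast
  then have "\<forall>\<^sub>F r in sequentially. g r * h r = poly (p * p') (of_nat r)"
    by eventually_elim simp
  then show ?thesis unfolding eventually_poly_def by blast
qed

lemma eventually_poly_sum:
  assumes "\<And>i. i \<in> I \<Longrightarrow> eventually_poly (g i)"
  shows "eventually_poly (\<lambda>r. \<Sum>i\<in>I. g i r)"
  using assms
  by (induction I rule: infinite_finite_induct) (auto intro: eventually_poly_const eventually_poly_add)

lemma eventually_poly_prod:
  assumes "\<And>i. i \<in> I \<Longrightarrow> eventually_poly (g i)"
  shows "eventually_poly (\<lambda>r. \<Prod>i\<in>I. g i r)"
  using assms
  by (induction I rule: infinite_finite_induct) (auto intro: eventually_poly_const eventually_poly_mult)

lemma eventually_poly_pochhammer:
  assumes "eventually_poly g"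
  shows "eventually_poly (\<lambda>r. pochhammer (g r) n)"
  unfolding pochhammer_prod
  by (intro eventually_poly_prod eventually_poly_add assms eventually_poly_const)

lemma eventually_poly_binomial: "eventually_poly (\<lambda>r. of_nat (r choose s))"
proof -
  have "of_nat (r choose s) = (\<Prod>i = 0..<s. of_nat r + - of_nat i) * (1 / fact s :: complex)" for r
    by (simp add: binomial_gbinomial gbinomial_prod_rev)
  then show ?thesis
    by (simp only:) (intro eventually_poly_mult eventually_poly_prod eventually_poly_add
        eventually_poly_const eventually_poly_of_nat)
qed

lemma eventually_poly_geometric_imp_eq_1:
  fixes x :: complex
  assumes "eventually_poly (\<lambda>r. x ^ r)" "x \<noteq> 0"
  shows "x = 1"
proof -
  obtain p N where p: "\<And>r. r \<ge> N \<Longrightarrow> x ^ r = poly p (of_nat r)"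
    using assms unfolding eventually_poly_def eventually_sequentially by blast
  let ?d = "pcompose p [:1, 1:] - smult x p"
  have "poly ?d (of_nat r) = 0" if "r \<ge> N" for r
    using p[of r] p[of "Suc r"] that by (simp add: poly_pcompose)
  then have "of_nat ` {N..} \<subseteq> {z. poly ?d z = 0}"
    by blast
  moreover have "infinite (of_nat ` {N..} :: complex set)"
    by (simp add: finite_image_iff infinite_Ici)
  ultimately have "?d = 0"
    using poly_roots_finite finite_subset by blast
  then have "lead_coeff (pcompose p [:1, 1:]) = x * lead_coeff p"
    by (simp add: lead_coeff_smult)
  \<comment> \<open>Composition with the monic linear polynomial \<open>[:1, 1:]\<close> keeps the
    leading coefficient.\<close>
  then have "lead_coeff p = x * lead_coeff p"
    by (subst (asm) lead_coeff_comp) simp_all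
  \<comment> \<open>Here \<open>x \<noteq> 0\<close> enters: the powers of 0 eventually agree with
    the zero polynomial.\<close>
  moreover have "p \<noteq> 0"
    using p[of N] assms(2) by auto
  ultimately show ?thesis
    by simp
qed

lemma not_eventually_poly_radial_coeff:
  assumes "0 < q" "q < 1"
  shows "\<not> eventually_poly (\<lambda>r. complex_of_real (radial_coeff q r))"
proof
  \<comment> \<open>Chosen to solve the formula for c_r for the geometric term: 1 - 2 (1 - q) c_r =
    q^(2r).\<close>
  let ?c = "complex_of_real (- 2 * (1 - q))"
  assume "eventually_poly (\<lambda>r. complex_of_real (radial_coeff q r))"
  then have "eventually_poly (\<lambda>r. 1 + ?c * complex_of_real (radial_coeff q r))"
    by (intro eventually_poly_add eventually_poly_mult eventually_poly_const)
  moreover have "1 + ?c * complex_of_real (radial_coeff q r) = complex_of_real (q\<^sup>2) ^ r" for r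
  proof -
    have "1 + (- 2 * (1 - q)) * radial_coeff q r = (q\<^sup>2) ^ r"
      using assms unfolding radial_coeff_def q_number_def power_mult by (simp add: field_simps)
    then show ?thesis
      by (metis of_real_1 of_real_add of_real_mult of_real_power)
  qed
  ultimately have "complex_of_real (q\<^sup>2) = 1"
    using assms by (intro eventually_poly_geometric_imp_eq_1) simp_all
  then have "q\<^sup>2 = 1"
    using of_real_eq_1_iff by blast
  then show False
    using assms by (simp add: power2_eq_1_iff)
qed

section \<open>Detecting nonzero vectors and nonzero pure tensors by linear functionals\<close>

lemma linear_functional_exists:
  fixes x :: "'a::complex_vector"
  assumes "x \<noteq> 0"
  obtains \<phi> :: "'a \<Rightarrow> complex" where "Vector_Spaces.linear scaleC scaleC \<phi>" "\<phi> x = 1"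
proof -
  interpret vector_space_pair "scaleC :: complex \<Rightarrow> 'a \<Rightarrow> 'a" "scaleC :: complex \<Rightarrow> complex \<Rightarrow> complex"
    by unfold_locales
  have "complex_vector.independent {x}"
    using assms by simp
  from linear_independent_extend[OF this, of "\<lambda>_. 1"] show ?thesis
    using that by auto
qed

text \<open>The product of functionals \<phi> and \<psi> with value 1 at x and y extends to a linear
  functional \<open>ev\<close> on the free space. It kills the relators, hence their span, but takes
  the value 1 at \<open>pure x y\<close>.\<close>

lemma tensor_neq_0:
  fixes x :: "'a::complex_vector" and y :: "'b::complex_vector"
  assumes "x \<noteq> 0" "y \<noteq> 0"
  shows "x \<otimes> y \<noteq> 0"
proof -
  obtain \<phi> :: "'a \<Rightarrow> complex" where \<phi>: "Vector_Spaces.linear scaleC scaleC \<phi>" "\<phi> x = 1"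
    using linear_functional_exists[OF assms(1)] .
  obtain \<psi> :: "'b \<Rightarrow> complex" where \<psi>: "Vector_Spaces.linear scaleC scaleC \<psi>" "\<psi> y = 1"
    using linear_functional_exists[OF assms(2)] .
  interpret \<phi>: Vector_Spaces.linear scaleC scaleC \<phi> by (rule \<phi>)
  interpret \<psi>: Vector_Spaces.linear scaleC scaleC \<psi> by (rule \<psi>)
  define ev where "ev u = Sum_any (\<lambda>k. lookup u k * (\<phi> (fst k) * \<psi> (snd k)))" for u
  \<comment> \<open>\<open>Sum_any\<close> defaults to 0 on infinite support; the finite support of
    u rules this out for every g.\<close>
  have fin: "finite {k. lookup u k * g k \<noteq> 0}" for u :: "('a \<times> 'b) \<Rightarrow>\<^sub>0 complex" and g
    by (rule finite_subset[OF _ finite_keys[of u]]) (auto simp: in_keys_iff)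
  have ev_add: "ev (u + v) = ev u + ev v" for u v
    by (simp add: ev_def lookup_add distrib_right Sum_any.distrib fin)
  have ev_scale: "ev (c *\<^sub>C u) = c * ev u" for c u
    by (simp add: ev_def lookup_scaleC scaleC_complex_def Sum_any_right_distrib[OF fin] mult.assoc)
  have ev_diff: "ev (u - v) = ev u - ev v" for u v
    using ev_add[of "u - v" v] by simp
  have ev_pure: "ev (pure x y) = \<phi> x * \<psi> y" for x y
  proof -
    have "ev (pure x y) = Sum_any (\<lambda>k. \<phi> (fst k) * \<psi> (snd k) when k = (x, y))"
      unfolding ev_def pure_def by (rule Sum_any.cong) (simp add: lookup_single when_def)
    then show ?thesis by (simp add: Sum_any_when_equal)
  qed
  have "ev u = 0" if "u \<in> complex_vector.span tensor_relators" for u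
    using that
  proof (induction rule: complex_vector.span_induct_alt)
    case base
    show ?case by (simp add: ev_def)
  next
    case (step c w v)
    have "ev w = 0"
      using step(1) unfolding tensor_relators_def
      by (auto simp: ev_diff ev_add ev_scale ev_pure \<phi>.add \<psi>.add \<phi>.scale \<psi>.scale
          scaleC_complex_def distrib_left distrib_right mult.left_commute)
    then show ?case
      using step by (simp add: ev_add ev_scale)
  qed
  moreover have "ev (pure x y) = 1"
    by (simp add: ev_pure \<phi> \<psi>)
  ultimately have "\<not> tensor_rel (pure x y) 0"
    unfolding tensor_rel_def by auto
  then show ?thesis
    by transfer
qed

section \<open>Coefficients of products, operator actions and derivatives\<close>

lemma multi_index_add_eq_iff:
  fixes m d \<delta> :: "'n multi_index"
  shows "\<delta> = m + d \<longleftrightarrow> m + (\<delta> - m) = \<delta> \<and> d = \<delta> - m"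
  by auto

text \<open>Subtraction of exponents is truncated, so \<open>m + (\<delta> - m) = \<delta>\<close>
  says that the monomial m divides \<delta>. This test recurs below.\<close>

lemma lookup_single_times:
  fixes p :: "('n, 'c::ring_1) vpoly"
  shows "lookup (Poly_Mapping.single m c * p) \<delta> =
    (if m + (\<delta> - m) = \<delta> then c * lookup p (\<delta> - m) else 0)"
proof -
  have "Sum_any (\<lambda>d. lookup p d when \<delta> = m + d) = (if m + (\<delta> - m) = \<delta> then lookup p (\<delta> - m) else 0)"
    by (subst multi_index_add_eq_iff) (simp add: Sum_any_when_equal flip: when_when)
  moreover have "lookup (Poly_Mapping.single m c * p) \<delta> =
      Sum_any (\<lambda>l. c * Sum_any (\<lambda>d. lookup p d when \<delta> = l + d) when l = m)"
    unfolding lookup_mult by (rule Sum_any.cong) (simp add: lookup_single when_def)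
  ultimately show ?thesis
    by (simp add: Sum_any_when_equal)
qed

lemma lookup_op_poly_act:
  assumes "op_poly_linear P"
  shows "lookup (op_poly_act P p) \<mu> =
    (\<Sum>\<gamma>\<in>Poly_Mapping.keys P. if \<gamma> + (\<mu> - \<gamma>) = \<mu> then lookup P \<gamma> (lookup p (\<mu> - \<gamma>)) else 0)"
proof -
  have "(\<Sum>\<delta>\<in>Poly_Mapping.keys p. lookup (Poly_Mapping.single (\<gamma> + \<delta>) (lookup P \<gamma> (lookup p \<delta>))) \<mu>) =
      (if \<gamma> + (\<mu> - \<gamma>) = \<mu> then lookup P \<gamma> (lookup p (\<mu> - \<gamma>)) else 0)" for \<gamma>
  proof -
    \<comment> \<open>Linearity gives value 0 at 0, which covers the case that
      \<open>\<mu> - \<gamma>\<close> is not a key of p.\<close>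
    interpret Vector_Spaces.linear scaleC scaleC "lookup P \<gamma>"
      using assms by (simp add: op_poly_linear_def)
    have "(\<Sum>\<delta>\<in>Poly_Mapping.keys p. lookup (Poly_Mapping.single (\<gamma> + \<delta>) (lookup P \<gamma> (lookup p \<delta>))) \<mu>) =
        (\<Sum>\<delta>\<in>Poly_Mapping.keys p. if \<delta> = \<mu> - \<gamma> then if \<gamma> + (\<mu> - \<gamma>) = \<mu> then lookup P \<gamma> (lookup p \<delta>) else 0 else 0)"
      by (intro sum.cong) (auto simp: lookup_single when_def)
    then show ?thesis
      by (simp add: in_keys_iff zero)
  qed
  then show ?thesis
    by (simp add: op_poly_act_def lookup_sum)
qed

text \<open>Seen from the target monomial \<delta>, the k derivatives bring down the exponents from
  \<open>lookup \<delta> v + k\<close> to \<open>lookup \<delta> v + 1\<close>; their product is a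
  rising factorial.\<close>

lemma lookup_partial_pow:
  "lookup ((partial v ^^ k) p) \<delta> =
    pochhammer (of_nat (lookup \<delta> v) + 1) k *\<^sub>C lookup p (\<delta> + Poly_Mapping.single v k)"
proof (induction k arbitrary: \<delta>)
  case (Suc k)
  have "\<delta> + Poly_Mapping.single v 1 + Poly_Mapping.single v k = \<delta> + Poly_Mapping.single v (Suc k)"
    by (simp add: add.assoc flip: single_add)
  then show ?case
    by (simp add: lookup_partial Suc scaleC_scaleC lookup_add pochhammer_rec add_ac del: One_nat_def)
qed (simp add: scaleC_one)

text \<open>For fixed \<alpha> the scalar factor is polynomial in the exponents of \<delta>; this is
  what makes differentiation harmless for polynomial dependence on r.\<close>

lemma lookup_partials:
  "lookup (partials \<alpha> p) \<delta> =
    (\<Prod>v\<in>UNIV. pochhammer (of_nat (lookup \<delta> v) + 1) (lookup \<alpha> v)) *\<^sub>C lookup p (\<delta> + \<alpha>)"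
proof -
  let ?D = "\<lambda>v. partial v ^^ lookup \<alpha> v"
  interpret comp_fun_commute ?D
    by unfold_locales (rule partial_pow_commute)
  have "lookup (Finite_Set.fold ?D p A) \<delta> =
      (\<Prod>v\<in>A. pochhammer (of_nat (lookup \<delta> v) + 1) (lookup \<alpha> v)) *\<^sub>C
        lookup p (\<delta> + (\<Sum>v\<in>A. Poly_Mapping.single v (lookup \<alpha> v)))" for A
    using finite[of A]
  proof (induction A arbitrary: \<delta> rule: finite_induct)
    case (insert v A)
    let ?s = "Poly_Mapping.single v (lookup \<alpha> v)"
    \<comment> \<open>The shift by \<open>?s\<close> changes only the exponent of v, and v is not in
      A.\<close>
    have "(\<Prod>w\<in>A. pochhammer (of_nat (lookup (\<delta> + ?s) w) + 1 :: complex) (lookup \<alpha> w)) =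
        (\<Prod>w\<in>A. pochhammer (of_nat (lookup \<delta> w) + 1) (lookup \<alpha> w))"
      using insert.hyps by (intro prod.cong refl) (auto simp: lookup_add lookup_single when_def)
    then show ?case
      using insert by (simp add: lookup_partial_pow scaleC_scaleC add_ac)
  qed (simp add: scaleC_one)
  moreover have "(\<Sum>v\<in>UNIV. Poly_Mapping.single v (lookup \<alpha> v)) = \<alpha>"
    by (rule poly_mapping_eqI) (simp add: lookup_sum lookup_single when_def)
  ultimately show ?thesis
    by (simp add: partials_def)
qed

section \<open>Coefficients of the powers of \<open>H\<close>\<close>

definition diag :: "'n \<Rightarrow> nat \<Rightarrow> 'n multi_index" where
  "diag a k = Poly_Mapping.single (Inl a) k + Poly_Mapping.single (Inr a) k"

lemma lookup_diag:
  "lookup (diag a k) (Inl b) = (if a = b then k else 0)"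
  "lookup (diag a k) (Inr b) = (if a = b then k else 0)"
  by (simp_all add: diag_def lookup_add lookup_single when_def)

lemma diag_add: "diag a k + diag a l = diag a (k + l)"
  by (simp add: diag_def single_add add_ac)

lemma multi_index_eqI:
  fixes \<gamma> \<delta> :: "'n multi_index"
  assumes "\<And>b. lookup \<gamma> (Inl b) = lookup \<delta> (Inl b)" "\<And>b. lookup \<gamma> (Inr b) = lookup \<delta> (Inr b)"
  shows "\<gamma> = \<delta>"
proof (rule poly_mapping_eqI)
  show "lookup \<gamma> v = lookup \<delta> v" for v
    using assms by (cases v) simp_all
qed

lemma lookup_H_power_Suc:
  "lookup (H ^ Suc r :: ('n::finite, 'c::ring_1) vpoly) \<delta> =
    (\<Sum>b\<in>UNIV. if diag b 1 + (\<delta> - diag b 1) = \<delta> then lookup (H ^ r) (\<delta> - diag b 1) else 0)"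
proof -
  have "(H :: ('n, 'c) vpoly) = (\<Sum>b\<in>UNIV. Poly_Mapping.single (diag b 1) 1)"
    by (simp add: H_def mult_single diag_def)
  from arg_cong[OF this, of "\<lambda>h. h * H ^ r"]
  have "(H ^ Suc r :: ('n, 'c) vpoly) = (\<Sum>b\<in>UNIV. Poly_Mapping.single (diag b 1) 1 * H ^ r)"
    by (simp only: power_Suc sum_distrib_right)
  then show ?thesis
    by (simp only: lookup_sum lookup_single_times mult_1_left)
qed

text \<open>Each monomial z_b zbar_b of \<open>H\<close> raises both exponents of a pair together,
  so splitting one off preserves an imbalance.\<close>

lemma lookup_H_power_unbalanced:
  assumes "lookup \<delta> (Inl a) \<noteq> lookup \<delta> (Inr a)"
  shows "lookup (H ^ r :: ('n::finite, 'c::ring_1) vpoly) \<delta> = 0"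
  using assms
proof (induction r arbitrary: \<delta>)
  case 0
  then show ?case by (auto simp: lookup_one when_def)
next
  case (Suc r)
  have "lookup (H ^ r :: ('n, 'c) vpoly) (\<delta> - diag b 1) = 0" if "diag b 1 + (\<delta> - diag b 1) = \<delta>" for b
  proof (rule Suc.IH)
    have "lookup \<delta> v = lookup (diag b 1) v + lookup (\<delta> - diag b 1) v" for v
      using that by (metis lookup_add)
    from this[of "Inl a"] this[of "Inr a"] Suc.prems
    show "lookup (\<delta> - diag b 1) (Inl a) \<noteq> lookup (\<delta> - diag b 1) (Inr a)"
      by (auto simp: lookup_diag split: if_splits)
  qed
  then show ?case
    unfolding lookup_H_power_Suc by (intro sum.neutral) simp
qed

text \<open>Of the r factors \<open>H\<close>, choose the k that supply z_a zbar_a; the remaining r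
  - k must produce \<nu>, which is free of both variables. The induction splits off one factor and
  ends in Pascal's rule. For k > r both sides vanish.\<close>

lemma lookup_H_power_diag:
  assumes "lookup \<nu> (Inl a) = 0" "lookup \<nu> (Inr a) = 0"
  shows "lookup (H ^ r :: ('n::finite, 'c::ring_1) vpoly) (\<nu> + diag a k) =
    of_nat (r choose k) * lookup (H ^ (r - k)) \<nu>"
  using assms
proof (induction r arbitrary: \<nu> k)
  case 0
  show ?case
  proof (cases k)
    case (Suc k')
    then have "lookup (\<nu> + diag a k) (Inl a) \<noteq> 0"
      by (simp add: lookup_add lookup_diag)
    then have "\<nu> + diag a k \<noteq> 0"
      by auto
    then show ?thesis
      using Suc by (simp add: lookup_one)
  qed (simp add: diag_def)
next
  case (Suc r)
  let ?t = "\<lambda>r \<delta> b. if diag b 1 + (\<delta> - diag b 1) = \<delta> then lookup (H ^ r :: ('n, 'c) vpoly) (\<delta> - diag b 1) else 0"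
  have a_term: "?t r (\<nu> + diag a k) a =
      (case k of 0 \<Rightarrow> 0 | Suc k' \<Rightarrow> of_nat (r choose k') * lookup (H ^ (Suc r - k)) \<nu>)"
  proof (cases k)
    case 0
    have "lookup (diag a 1 + (\<nu> + diag a k - diag a 1)) (Inl a) \<noteq> lookup (\<nu> + diag a k) (Inl a)"
      using 0 Suc.prems by (simp add: lookup_add lookup_diag)
    then show ?thesis
      using 0 by auto
  next
    case (Suc k')
    have "\<nu> + diag a k = (\<nu> + diag a k') + diag a 1"
      using Suc by (simp add: add.assoc diag_add)
    then have "?t r (\<nu> + diag a k) a = lookup (H ^ r) (\<nu> + diag a k')"
      by (simp add: add.commute)
    then show ?thesis
      using Suc Suc.IH[OF Suc.prems, of k'] by simp
  qed
  have b_term: "?t r (\<nu> + diag a k) b = of_nat (r choose k) * ?t (r - k) \<nu> b" if "b \<noteq> a" for b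
  proof (cases "diag b 1 + (\<nu> - diag b 1) = \<nu>")
    case True
    then obtain \<rho> where \<rho>: "\<nu> = \<rho> + diag b 1"
      by (metis add.commute)
    have "lookup \<rho> (Inl a) = 0" "lookup \<rho> (Inr a) = 0"
      using Suc.prems that by (simp_all add: \<rho> lookup_add lookup_diag)
    from Suc.IH[OF this, of k] have "lookup (H ^ r) (\<rho> + diag a k) = of_nat (r choose k) * lookup (H ^ (r - k) :: ('n, 'c) vpoly) \<rho>" .
    moreover have "\<nu> + diag a k = (\<rho> + diag a k) + diag b 1"
      by (simp add: \<rho> add_ac)
    ultimately show ?thesis
      by (simp add: \<rho> add.commute)
  next
    case False
    \<comment> \<open>As b differs from a, multiplying by \<open>diag a k\<close> cannot create
      divisibility by z_b zbar_b.\<close>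
    have "diag b 1 + (\<nu> + diag a k - diag b 1) \<noteq> \<nu> + diag a k"
    proof
      assume eq: "diag b 1 + (\<nu> + diag a k - diag b 1) = \<nu> + diag a k"
      have "diag b 1 + (\<nu> - diag b 1) = \<nu>"
      proof (rule multi_index_eqI)
        fix c
        show "lookup (diag b 1 + (\<nu> - diag b 1)) (Inl c) = lookup \<nu> (Inl c)"
          using arg_cong[OF eq, of "\<lambda>m. lookup m (Inl c)"] that Suc.prems
          by (auto simp: lookup_add lookup_minus lookup_diag split: if_splits)
        show "lookup (diag b 1 + (\<nu> - diag b 1)) (Inr c) = lookup \<nu> (Inr c)"
          using arg_cong[OF eq, of "\<lambda>m. lookup m (Inr c)"] that Suc.prems
          by (auto simp: lookup_add lookup_minus lookup_diag split: if_splits)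
      qed
      with False show False by blast
    qed
    with False show ?thesis by simp
  qed
  have a_zero: "?t (r - k) \<nu> a = 0"
  proof -
    have "lookup (diag a 1 + (\<nu> - diag a 1)) (Inl a) \<noteq> lookup \<nu> (Inl a)"
      using Suc.prems by (simp add: lookup_add lookup_diag)
    then show ?thesis by auto
  qed
  have "lookup (H ^ Suc r :: ('n, 'c) vpoly) (\<nu> + diag a k) =
      ?t r (\<nu> + diag a k) a + (\<Sum>b\<in>UNIV - {a}. ?t r (\<nu> + diag a k) b)"
    unfolding lookup_H_power_Suc by (rule sum.remove) simp_all
  also have "(\<Sum>b\<in>UNIV - {a}. ?t r (\<nu> + diag a k) b) = of_nat (r choose k) * (\<Sum>b\<in>UNIV - {a}. ?t (r - k) \<nu> b)"
    unfolding sum_distrib_left by (rule sum.cong) (use b_term in auto)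
  \<comment> \<open>Restoring the vanishing term at a turns the sum into a coefficient of a full
    power of \<open>H\<close>.\<close>
  also have "(\<Sum>b\<in>UNIV - {a}. ?t (r - k) \<nu> b) = (\<Sum>b\<in>UNIV. ?t (r - k) \<nu> b)"
    using a_zero by (subst (2) sum.remove[of _ a]) simp_all
  also have "\<dots> = lookup (H ^ Suc (r - k)) \<nu>"
    by (rule lookup_H_power_Suc[symmetric])
  also have "?t r (\<nu> + diag a k) a + of_nat (r choose k) * lookup (H ^ Suc (r - k)) \<nu> =
      of_nat (Suc r choose k) * lookup (H ^ (Suc r - k)) \<nu>"
  proof (cases k)
    case 0
    then show ?thesis
      unfolding a_term by simp
  next
    case (Suc k')
    \<comment> \<open>The two exponents differ only for k > r, where the binomial coefficient is
      0.\<close>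
    have "of_nat (r choose k) * lookup (H ^ Suc (r - k)) \<nu> =
        of_nat (r choose k) * lookup (H ^ (Suc r - k) :: ('n, 'c) vpoly) \<nu>"
      by (cases "k \<le> r") (simp_all add: Suc_diff_le binomial_eq_0)
    then show ?thesis
      unfolding a_term using Suc by (simp add: distrib_right)
  qed
  finally show ?case .
qed

section \<open>Polynomial dependence on r of the coefficients on the left-hand side\<close>

lemma of_nat_times_conv_scaleC: "of_nat n * x = (of_nat n :: complex) *\<^sub>C x"
  for x :: "'c::complex_algebra_1"
proof (induction n)
  case (Suc n)
  then show ?case
    by (simp add: distrib_right scaleC_add_left scaleC_one)
qed simp

text \<open>For large r the exponents of z_a and zbar_a in the monomial differ by a constant. If it
  is nonzero, the coefficient vanishes; otherwise both equal r minus a constant, and the binomial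
  formula applies.\<close>

lemma eventually_poly_lookup_H_power:
  fixes a :: "'n::finite" and \<gamma> \<alpha> :: "'n multi_index"
    and \<chi> :: "'c::complex_algebra_1 \<Rightarrow> complex"
  defines "\<mu> \<equiv> \<lambda>r. Poly_Mapping.single (Inl a) (r - 1) + Poly_Mapping.single (Inr a) r"
  assumes "Vector_Spaces.linear scaleC scaleC \<chi>"
  shows "eventually_poly (\<lambda>r. \<chi> (lookup (H ^ r) (\<mu> r - \<gamma> + \<alpha>)))"
proof -
  interpret Vector_Spaces.linear scaleC scaleC \<chi> by (rule assms)
  let ?\<gamma> = "lookup \<gamma>" and ?\<alpha> = "lookup \<alpha>"
  have lookup_\<mu>: "lookup (\<mu> r) (Inl b) = (if a = b then r - 1 else 0)"
    "lookup (\<mu> r) (Inr b) = (if a = b then r else 0)" for r b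
    by (simp_all add: \<mu>_def lookup_add lookup_single when_def)
  \<comment> \<open>From here on, subtracting \<gamma> from the exponents r - 1 and r at a is not
    truncated.\<close>
  let ?large = "\<lambda>r. r \<ge> 1 + ?\<gamma> (Inl a) + ?\<gamma> (Inr a)"
  show ?thesis
  \<comment> \<open>Equality of the two exponents
    \<open>r - 1 - ?\<gamma> (Inl a) + ?\<alpha> (Inl a)\<close> and
    \<open>r - ?\<gamma> (Inr a) + ?\<alpha> (Inr a)\<close>, with r cancelled.\<close>
  proof (cases "?\<alpha> (Inr a) + 1 + ?\<gamma> (Inl a) = ?\<alpha> (Inl a) + ?\<gamma> (Inr a)")
    case False
    have "\<chi> (lookup (H ^ r) (\<mu> r - \<gamma> + \<alpha>)) = 0" if "?large r" for r
    proof -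
      have "lookup (\<mu> r - \<gamma> + \<alpha>) (Inl a) \<noteq> lookup (\<mu> r - \<gamma> + \<alpha>) (Inr a)"
        using False that by (simp add: lookup_add lookup_minus lookup_\<mu>)
      then show ?thesis
        by (simp add: lookup_H_power_unbalanced zero)
    qed
    then show ?thesis
      by (intro eventually_poly_cong[OF eventually_poly_const[of 0]] eventually_sequentiallyI)
  next
    case balanced: True
    \<comment> \<open>The part of \<alpha> away from a. There \<open>\<mu> r\<close> is 0, so the
      truncated difference with \<gamma> is 0 as well and only \<alpha> remains.\<close>
    define \<nu> where "\<nu> = \<alpha> - Poly_Mapping.single (Inl a) (?\<alpha> (Inl a)) - Poly_Mapping.single (Inr a) (?\<alpha> (Inr a))"
    have lookup_\<nu>: "lookup \<nu> (Inl b) = (if a = b then 0 else ?\<alpha> (Inl b))"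
      "lookup \<nu> (Inr b) = (if a = b then 0 else ?\<alpha> (Inr b))" for b
      by (auto simp: \<nu>_def lookup_minus lookup_single when_def)
    define k where "k r = r - 1 - ?\<gamma> (Inl a) + ?\<alpha> (Inl a)" for r
    have "\<mu> r - \<gamma> + \<alpha> = \<nu> + diag a (k r)" if "?large r" for r
      by (rule multi_index_eqI)
        (use balanced that in \<open>auto simp: lookup_add lookup_minus lookup_\<mu> lookup_\<nu> lookup_diag k_def\<close>)
    then have eq: "\<chi> (lookup (H ^ r) (\<mu> r - \<gamma> + \<alpha>)) =
        of_nat (r choose k r) * \<chi> (lookup (H ^ (r - k r)) \<nu>)" if "?large r" for r
      using that lookup_H_power_diag[of \<nu> a r "k r", where 'c='c]
      by (simp add: lookup_\<nu> of_nat_times_conv_scaleC scale scaleC_complex_def)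
    show ?thesis
    proof (cases "?\<alpha> (Inl a) \<le> 1 + ?\<gamma> (Inl a)")
      case True
      \<comment> \<open>This is \<open>r - k r\<close>, the number of factors not supplying z_a
        zbar_a. It no longer depends on r, and symmetry turns \<open>r choose k r\<close> into
        \<open>r choose ?s\<close>.\<close>
      let ?s = "1 + ?\<gamma> (Inl a) - ?\<alpha> (Inl a)"
      have "\<chi> (lookup (H ^ r) (\<mu> r - \<gamma> + \<alpha>)) = of_nat (r choose ?s) * \<chi> (lookup (H ^ ?s) \<nu>)"
        if "?large r" for r
      proof -
        have "r - k r = ?s" "k r \<le> r"
          using that True by (auto simp: k_def)
        then show ?thesis
          using eq[OF that] binomial_symmetric[of "k r" r] by simp
      qed
      then show ?thesis
        by (intro eventually_poly_cong[OF eventually_poly_mult[OF eventually_poly_binomial[of ?s]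
                eventually_poly_const[of "\<chi> (lookup (H ^ ?s) \<nu>)"]]] eventually_sequentiallyI)
    next
      case False
      have "\<chi> (lookup (H ^ r) (\<mu> r - \<gamma> + \<alpha>)) = 0" if "?large r" for r
      proof -
        have "r < k r"
          using that False by (simp add: k_def)
        then show ?thesis
          using eq[OF that] by (simp add: binomial_eq_0)
      qed
      then show ?thesis
        by (intro eventually_poly_cong[OF eventually_poly_const[of 0]] eventually_sequentiallyI)
    qed
  qed
qed

text \<open>The coefficient is a sum over pairs of \<alpha> and \<gamma> whose range does not depend
  on r, so each summand can be treated with \<alpha> and \<gamma> fixed.\<close>

lemma eventually_poly_differential_local:
  fixes a :: "'n::finite" and \<chi> :: "('c::complex_algebra_1, 'f::complex_vector) tensor \<Rightarrow> complex"
    and T :: "('n, ('c, 'f) tensor) vpoly \<Rightarrow> ('n, ('c, 'f) tensor) vpoly"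
  defines "\<mu> \<equiv> \<lambda>r. Poly_Mapping.single (Inl a) (r - 1) + Poly_Mapping.single (Inr a) r"
  assumes T: "ordinary_differential_local T" and \<chi>: "Vector_Spaces.linear scaleC scaleC \<chi>"
  shows "eventually_poly (\<lambda>r. \<chi> (lookup (T (H ^ r \<bullet> e)) (\<mu> r)))"
proof -
  interpret \<chi>: Vector_Spaces.linear scaleC scaleC \<chi> by (rule \<chi>)
  obtain R and P :: "'n multi_index \<Rightarrow> ('n, ('c, 'f) tensor \<Rightarrow> ('c, 'f) tensor) vpoly"
    where P: "\<And>\<alpha>. op_poly_linear (P \<alpha>)"
      and T_eq: "\<And>p. T p = (\<Sum>\<alpha> | total_degree \<alpha> \<le> R. op_poly_act (P \<alpha>) (partials \<alpha> p))"
    using T unfolding ordinary_differential_local_def by blast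
  have lookup_\<mu>: "lookup (\<mu> r) v = (if v = Inl a then r - 1 else if v = Inr a then r else 0)" for r v
    by (auto simp: \<mu>_def lookup_add lookup_single when_def)
  have "eventually_poly (\<lambda>r. \<chi> (if \<gamma> + (\<mu> r - \<gamma>) = \<mu> r
      then lookup (P \<alpha>) \<gamma> (lookup (partials \<alpha> (H ^ r \<bullet> e)) (\<mu> r - \<gamma>)) else 0))" (is "eventually_poly ?g")
    for \<alpha> \<gamma>
  proof -
    interpret P: Vector_Spaces.linear scaleC scaleC "lookup (P \<alpha>) \<gamma>"
      using P by (simp add: op_poly_linear_def)
    let ?b = "1 + lookup \<gamma> (Inl a) + lookup \<gamma> (Inr a)"
    show ?thesis
    \<comment> \<open>For r from \<open>?b\<close> on, \<gamma> divides \<open>\<mu> r\<close>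
      exactly when \<gamma> involves only z_a and zbar_a, so testing at \<open>?b\<close> decides
      all these r.\<close>
    proof (cases "\<gamma> + (\<mu> ?b - \<gamma>) = \<mu> ?b")
      case True
      have outside: "lookup \<gamma> v = 0" if "v \<noteq> Inl a" "v \<noteq> Inr a" for v
        using arg_cong[OF True, of "\<lambda>m. lookup m v"] that by (simp add: lookup_add lookup_\<mu>)
      let ?h = "\<lambda>r. (\<Prod>v\<in>UNIV. pochhammer (of_nat (lookup (\<mu> r - \<gamma>) v) + 1) (lookup \<alpha> v)) *
          \<chi> (lookup (P \<alpha>) \<gamma> (lookup (H ^ r) (\<mu> r - \<gamma> + \<alpha>) \<otimes> e))"
      have g_eq_h: "?g r = ?h r" if "r \<ge> ?b" for r
      proof -
        have "\<gamma> + (\<mu> r - \<gamma>) = \<mu> r"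
          using that outside by (intro poly_mapping_eqI) (auto simp: lookup_add lookup_minus lookup_\<mu>)
        then show ?thesis
          by (simp add: lookup_partials lookup_apply_coeff P.scale \<chi>.scale scaleC_complex_def)
      qed
      have "eventually_poly (\<lambda>r. of_nat (lookup (\<mu> r - \<gamma>) v))" for v
      proof -
        let ?c = "if v = Inl a then - 1 - of_nat (lookup \<gamma> v) else - of_nat (lookup \<gamma> v) :: complex"
        have eq: "of_nat (lookup (\<mu> r - \<gamma>) v) = (if v = Inl a \<or> v = Inr a then of_nat r + ?c else 0)"
          if "r \<ge> ?b" for r
          using that by (auto simp: lookup_minus lookup_\<mu> of_nat_diff)
        have "eventually_poly (\<lambda>r. if v = Inl a \<or> v = Inr a then of_nat r + ?c else 0)"
          by (cases "v = Inl a \<or> v = Inr a")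
            (auto intro: eventually_poly_add eventually_poly_const eventually_poly_of_nat
              simp del: add_uminus_conv_diff)
        then show ?thesis
          by (rule eventually_poly_cong) (rule eventually_sequentiallyI, rule eq)
      qed
      moreover have "eventually_poly (\<lambda>r. \<chi> (lookup (P \<alpha>) \<gamma> (lookup (H ^ r) (\<mu> r - \<gamma> + \<alpha>) \<otimes> e)))"
        unfolding \<mu>_def
      proof (rule eventually_poly_lookup_H_power)
        \<comment> \<open>The operator coefficient and the tensor factor \<open>e\<close> are
          absorbed into the functional.\<close>
        show "Vector_Spaces.linear scaleC scaleC (\<lambda>c. \<chi> (lookup (P \<alpha>) \<gamma> (c \<otimes> e)))"
          by unfold_locales (simp_all add: tensor_add_left tensor_scaleC_left P.add P.scale \<chi>.add \<chi>.scale)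
      qed
      ultimately have "eventually_poly ?h"
        by (intro eventually_poly_mult eventually_poly_prod eventually_poly_pochhammer
            eventually_poly_add eventually_poly_const)
      then show ?thesis
        by (rule eventually_poly_cong) (rule eventually_sequentiallyI, rule g_eq_h)
    next
      case False
      have "?g r = 0" if "r \<ge> ?b" for r
      proof -
        have "\<gamma> + (\<mu> r - \<gamma>) \<noteq> \<mu> r"
        proof
          assume eq: "\<gamma> + (\<mu> r - \<gamma>) = \<mu> r"
          have "\<gamma> + (\<mu> ?b - \<gamma>) = \<mu> ?b"
          proof (rule poly_mapping_eqI)
            fix v
            show "lookup (\<gamma> + (\<mu> ?b - \<gamma>)) v = lookup (\<mu> ?b) v"
              using arg_cong[OF eq, of "\<lambda>m. lookup m v"] by (auto simp: lookup_add lookup_minus lookup_\<mu>)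
          qed
          with False show False by blast
        qed
        then show ?thesis by (simp add: \<chi>.zero)
      qed
      then show ?thesis
        by (intro eventually_poly_cong[OF eventually_poly_const[of 0]] eventually_sequentiallyI)
    qed
  qed
  then show ?thesis
    by (simp add: T_eq lookup_sum lookup_op_poly_act P \<chi>.sum eventually_poly_sum)
qed

section \<open>The coefficient on the right-hand side and the contradiction\<close>

lemma lookup_Zdag_H_power:
  fixes fd :: "'n::finite \<Rightarrow> 'c::complex_algebra_1"
  shows "lookup (Zdag fd * H ^ r) (Poly_Mapping.single (Inl a) r + Poly_Mapping.single (Inr a) (Suc r)) = fd a"
proof -
  let ?m = "\<lambda>b. Poly_Mapping.single (Inr b) (1::nat)"
  let ?\<mu> = "Poly_Mapping.single (Inl a) r + Poly_Mapping.single (Inr a) (Suc r)"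
  have "Zdag fd * H ^ r = (\<Sum>b\<in>UNIV. Poly_Mapping.single (?m b) (fd b) * H ^ r)"
    by (simp add: Zdag_def mult_single sum_distrib_right)
  then have "lookup (Zdag fd * H ^ r) ?\<mu> =
      (\<Sum>b\<in>UNIV. if ?m b + (?\<mu> - ?m b) = ?\<mu> then fd b * lookup (H ^ r) (?\<mu> - ?m b) else 0)"
    by (simp only: lookup_sum lookup_single_times)
  also have "\<dots> = (\<Sum>b\<in>UNIV. if b = a then fd b else 0)"
  proof (rule sum.cong[OF refl])
    fix b
    show "(if ?m b + (?\<mu> - ?m b) = ?\<mu> then fd b * lookup (H ^ r) (?\<mu> - ?m b) else 0) =
        (if b = a then fd b else 0)"
    proof (cases "b = a")
      case True
      have \<mu>: "?\<mu> = ?m a + (0 + diag a r)"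
        by (simp add: diag_def add_ac flip: single_add)
      \<comment> \<open>With \<nu> = 0 and k = r the binomial formula gives
        \<open>r choose r\<close> times the constant term of \<open>H ^ 0\<close>.\<close>
      have "lookup (H ^ r) (0 + diag a r) = (1 :: 'c)"
        by (subst lookup_H_power_diag) simp_all
      then show ?thesis
        unfolding \<mu> using True by simp
    next
      case False
      \<comment> \<open>For b other than a, zbar_b does not divide the monomial.\<close>
      have "lookup (?m b + (?\<mu> - ?m b)) (Inr b) \<noteq> lookup ?\<mu> (Inr b)"
        using False by (simp add: lookup_add lookup_single when_def)
      then show ?thesis
        using False by auto
    qed
  qed
  finally show ?thesis by simp
qed

theorem theorem7p2:
  fixes f fd :: "'n::finite \<Rightarrow> 'c::complex_algebra_1"
    and e :: "'f::complex_vector"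
    and q :: real
  assumes "clifford_witt_basis f fd"
    and "0 < q" and "q < 1"
    and "e \<noteq> 0"
  shows "\<not> (\<exists>T :: ('n, ('c, 'f) tensor) vpoly \<Rightarrow> ('n, ('c, 'f) tensor) vpoly.
           ordinary_differential_local T \<and>
           (\<forall>r\<ge>1. T (H ^ r \<bullet> e) =
             complex_of_real (radial_coeff q r) *\<^sub>C ((Zdag fd * H ^ (r - 1)) \<bullet> e)))"
proof
  assume "\<exists>T :: ('n, ('c, 'f) tensor) vpoly \<Rightarrow> ('n, ('c, 'f) tensor) vpoly.
    ordinary_differential_local T \<and>
    (\<forall>r\<ge>1. T (H ^ r \<bullet> e) =
      complex_of_real (radial_coeff q r) *\<^sub>C ((Zdag fd * H ^ (r - 1)) \<bullet> e))"
  then obtain T :: "('n, ('c, 'f) tensor) vpoly \<Rightarrow> ('n, ('c, 'f) tensor) vpoly"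
    where T: "ordinary_differential_local T"
      and T_eq: "\<And>r. r \<ge> 1 \<Longrightarrow> T (H ^ r \<bullet> e) =
        complex_of_real (radial_coeff q r) *\<^sub>C ((Zdag fd * H ^ (r - 1)) \<bullet> e)"
    by blast
  fix a :: 'n
  \<comment> \<open>If \<open>fd a\<close> were 0, this relation would read 0 = 1.\<close>
  have "f a * fd a + fd a * f a = 1"
    using assms(1) by (simp add: clifford_witt_basis_def)
  then have "fd a \<noteq> 0"
    by auto
  then obtain \<chi> :: "('c, 'f) tensor \<Rightarrow> complex"
    where \<chi>: "Vector_Spaces.linear scaleC scaleC \<chi>" "\<chi> (fd a \<otimes> e) = 1"
    using linear_functional_exists[OF tensor_neq_0[OF _ assms(4)]] by blast
  interpret \<chi>: Vector_Spaces.linear scaleC scaleC \<chi> by (rule \<chi>)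
  let ?\<mu> = "\<lambda>r. Poly_Mapping.single (Inl a) (r - 1) + Poly_Mapping.single (Inr a) r"
  \<comment> \<open>The normalisation of \<chi> at \<open>fd a \<otimes> e\<close> makes it return
    exactly c_r.\<close>
  have "complex_of_real (radial_coeff q r) = \<chi> (lookup (T (H ^ r \<bullet> e)) (?\<mu> r))" if "r \<ge> 1" for r
    using that lookup_Zdag_H_power[of fd "r - 1" a]
    by (simp add: T_eq lookup_scaleC lookup_apply_coeff \<chi>.scale \<chi> scaleC_complex_def)
  then have "eventually_poly (\<lambda>r. complex_of_real (radial_coeff q r))"
    by (intro eventually_poly_cong[OF eventually_poly_differential_local[OF T \<chi>(1), of e a]]
        eventually_sequentiallyI)
  then show False
    using not_eventually_poly_radial_coeff assms by blast
qed

end
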